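(* For every integer $m\ge 0$, the following identities hold in $\mathbf U$: \[ \mathfrak t_{\mathrm{odd}}^{(2m)} = \sum_{c=0}^m \sum_{a=0}^{2m-2c} q^{\binom{2c}{2} -a(2m-2c-a)}\, \check E^{(a)} \begin{Bmatrix} h;1-m\\ c\end{Bmatrix} F^{(2m-2c-a)}, \] \[ \mathfrak t_{\mathrm{odd}}^{(2m+1)} = \sum_{c=0}^{m} \sum_{a=0}^{2m+1-2c} q^{\binom{2c-1}{2}-1 -a(2m+1-2c-a)}\, \check E^{(a)} \begin{Bmatrix} h;1-m\\ c\end{Bmatrix} F^{(2m+1-2c-a)}. \]
   Context: $\mathbf U=\mathbf U_q(\mathfrak{sl}_2)$ is the $\mathbb Q(q)$-algebra generated by $E,F,K,K^{-1}$ with relations $KK^{-1}=K^{-1}K=1$, $EF-FE=\frac{K-K^{-1}}{q-q^{-1}}$, $KE=q^2EK$, $KF=q^{-2}FK$. For $n\in\mathbb Z$, $[n]=\frac{q^n-q^{-n}}{q-q^{-1}}$, and $[n]!=[1][2]\cdots[n]$ for $n\ge 0$ (with $[0]!=1$). Put $\check E=q^{-1}EK^{-1}$, $\mathfrak t=\check E+F$, and $\check E^{(n)}=\check E^n/[n]!$, $F^{(n)}=F^n/[n]!$ for $n\ge 0$. (The symbol $h$ stands for $h=\frac{K^{-2}-1}{q^2-1}$.) For $a\in\mathbb Z$, $n\ge 0$, \[ \begin{Bmatrix} h;a\\ n\end{Bmatrix}=\prod_{i=1}^n\frac{q^{4a+4i-4}K^{-2}-q^2}{q^{4i}-1} \]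 (equal to $1$ for $n=0$). In exponents, $\binom{x}{2}=x(x-1)/2$ for all integers $x$ (in particular $\binom{-1}{2}=1$). The $\imath$-divided powers $\mathfrak t_{\mathrm{odd}}^{(n)}$ are the polynomials in $\mathfrak t$ given, for $a\ge 0$, by \[ \mathfrak t_{\mathrm{odd}}^{(2a)}=\frac{1}{[2a]!}\prod_{i=1-a}^{a}(\mathfrak t-[2i-1]),\qquad \mathfrak t_{\mathrm{odd}}^{(2a+1)}=\frac{1}{[2a+1]!}\,\mathfrak t\prod_{i=1-a}^{a}(\mathfrak t-[2i-1]). \] Equivalently, $\mathfrak t_{\mathrm{odd}}^{(0)}=1$ and for $a\ge 0$: $\mathfrak t\cdot\mathfrak t_{\mathrm{odd}}^{(2a)}=[2a+1]\,\mathfrak t_{\mathrm{odd}}^{(2a+1)}$, $\mathfrak t\cdot\mathfrak t_{\mathrm{odd}}^{(2a+1)}=[2a+2]\,\mathfrak t_{\mathrm{odd}}^{(2a+2)}+[2a+1]\,\mathfrak t_{\mathrm{odd}}^{(2a)}$. *)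

theory Defs
  imports
    "HOL-Library.Poly_Mapping"
    "HOL-Computational_Algebra.Computational_Algebra"
begin

section \<open>The field \<open>\<rat>(q)\<close>\<close>

type_synonym qrat = "rat poly fract"

definition q :: qrat where
  "q = Fract [:0, 1:] 1"

definition qint :: "int \<Rightarrow> qrat" where
  "qint n = (q powi n - q powi (-n)) / (q - q powi (-1))"

definition qfact :: "nat \<Rightarrow> qrat" where
  "qfact n = (\<Prod>i = 1..n. qint (int i))"

text \<open>The division is exact for every integer \<open>x\<close>, also a negative one.\<close>
definition binom2 :: "int \<Rightarrow> int" where
  "binom2 x = x * (x - 1) div 2"


section \<open>The free \<open>\<rat>(q)\<close>-algebra on the symbols \<open>E, F, K, K\<inverse>\<close>\<close>

datatype ugen = GenE | GenF | GenK | GenKinv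

text \<open>Words form the free monoid. It is written additively because the convolution product of
  \<^typ>\<open>'a \<Rightarrow>\<^sub>0 'b\<close> is taken with respect to \<open>+\<close> on \<^typ>\<open>'a\<close>.\<close>

datatype uword = UWord (letters: "ugen list")

instantiation uword :: monoid_add
begin

definition "0 = UWord []"

definition "v + w = UWord (letters v @ letters w)"

instance
  by standard (simp_all add: zero_uword_def plus_uword_def)

end

type_synonym ufree = "uword \<Rightarrow>\<^sub>0 qrat"

definition free_scalar :: "qrat \<Rightarrow> ufree" where
  "free_scalar c = Poly_Mapping.single 0 c"

definition free_gen :: "ugen \<Rightarrow> ufree" where
  "free_gen g = Poly_Mapping.single (UWord [g]) 1"

text \<open>For every defining relation \<open>l = r\<close> of the quantum group the set contains \<open>l - r\<close>.\<close>
definition urelators :: "ufree set" where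
  "urelators =
    {free_gen GenK * free_gen GenKinv - 1,
     free_gen GenKinv * free_gen GenK - 1,
     free_gen GenE * free_gen GenF - free_gen GenF * free_gen GenE
       - free_scalar (1 / (q - q powi (-1))) * (free_gen GenK - free_gen GenKinv),
     free_gen GenK * free_gen GenE - free_scalar (q ^ 2) * (free_gen GenE * free_gen GenK),
     free_gen GenK * free_gen GenF - free_scalar (q powi (-2)) * (free_gen GenF * free_gen GenK)}"

text \<open>The two-sided ideal generated by the relators. It is closed under negation and scalar
  multiplication because \<open>a\<close> is an arbitrary element of the free algebra.\<close>
inductive_set uideal :: "ufree set" where
  zero: "0 \<in> uideal"
| add: "x \<in> uideal \<Longrightarrow> y \<in> uideal \<Longrightarrow> x + y \<in> uideal"
| gen: "r \<in> urelators \<Longrightarrow> a * r * b \<in> uideal"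

lemma uideal_mult_left: "x \<in> uideal \<Longrightarrow> c * x \<in> uideal"
proof (induction rule: uideal.induct)
  case (gen r a b)
  then show ?case using uideal.gen[of r "c * a" b] by (simp add: mult.assoc)
qed (auto simp: distrib_left intro: uideal.intros)

lemma uideal_mult_right: "x \<in> uideal \<Longrightarrow> x * c \<in> uideal"
proof (induction rule: uideal.induct)
  case (gen r a b)
  then show ?case using uideal.gen[of r a "b * c"] by (simp add: mult.assoc)
qed (auto simp: distrib_right intro: uideal.intros)

lemma uideal_uminus: "x \<in> uideal \<Longrightarrow> - x \<in> uideal"
  using uideal_mult_left[of x "- 1"] by simp

lemma uideal_diff: "x \<in> uideal \<Longrightarrow> y \<in> uideal \<Longrightarrow> x - y \<in> uideal"
  using uideal.add[of x "- y"] uideal_uminus[of y] by simp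

lemma urelators_uideal: "r \<in> urelators \<Longrightarrow> r \<in> uideal"
  using uideal.gen[of r 1 1] by simp

subsection \<open>The ideal is proper\<close>

text \<open>The counit \<open>E, F \<mapsto> 0\<close>, \<open>K, K\<inverse> \<mapsto> 1\<close> annihilates the ideal. This is needed for
  \<open>0 \<noteq> 1\<close> in the quotient, a class axiom of \<^class>\<open>ring_1\<close>.\<close>

definition word_counit :: "uword \<Rightarrow> qrat" where
  "word_counit w = (\<Prod>g\<leftarrow>letters w. if g = GenK \<or> g = GenKinv then 1 else 0)"

definition free_counit :: "ufree \<Rightarrow> qrat" where
  "free_counit f = (\<Sum>w\<in>Poly_Mapping.keys f. Poly_Mapping.lookup f w * word_counit w)"

lemma free_counit_superset:
  assumes "finite A" "Poly_Mapping.keys f \<subseteq> A"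
  shows "free_counit f = (\<Sum>w\<in>A. Poly_Mapping.lookup f w * word_counit w)"
  unfolding free_counit_def using assms
  by (intro sum.mono_neutral_left) (auto simp: in_keys_iff)

lemma free_counit_add: "free_counit (f + g) = free_counit f + free_counit g"
proof -
  let ?A = "Poly_Mapping.keys f \<union> Poly_Mapping.keys g"
  have "Poly_Mapping.keys (f + g) \<subseteq> ?A" by (rule keys_add)
  then show ?thesis
    by (simp add: free_counit_superset[of ?A] Poly_Mapping.lookup_add distrib_right sum.distrib)
qed

lemma free_counit_0 [simp]: "free_counit 0 = 0"
  by (simp add: free_counit_def)

lemma free_counit_sum: "free_counit (sum f A) = (\<Sum>i\<in>A. free_counit (f i))"
  by (induction A rule: infinite_finite_induct) (simp_all add: free_counit_add)

lemma free_counit_diff: "free_counit (f - g) = free_counit f - free_counit g"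
  using free_counit_add[of "f - g" g] by simp

lemma free_counit_single [simp]: "free_counit (Poly_Mapping.single w c) = c * word_counit w"
  by (simp add: free_counit_def)

lemma word_counit_add [simp]: "word_counit (v + w) = word_counit v * word_counit w"
  by (simp add: word_counit_def plus_uword_def)

lemma ufree_monomials:
  fixes f :: ufree
  shows "f = (\<Sum>w\<in>Poly_Mapping.keys f. Poly_Mapping.single w (Poly_Mapping.lookup f w))"
  by (intro poly_mapping_eqI)
     (auto simp: lookup_sum lookup_single when_def in_keys_iff sum.delta)

lemma free_counit_mult: "free_counit (f * g) = free_counit f * free_counit g"
proof -
  have "f * g = (\<Sum>v\<in>Poly_Mapping.keys f. \<Sum>w\<in>Poly_Mapping.keys g.
      Poly_Mapping.single (v + w) (Poly_Mapping.lookup f v * Poly_Mapping.lookup g w))"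
    by (subst ufree_monomials[of f], subst ufree_monomials[of g])
       (simp add: sum_product mult_single)
  then have "free_counit (f * g) =
      (\<Sum>v\<in>Poly_Mapping.keys f. \<Sum>w\<in>Poly_Mapping.keys g.
        Poly_Mapping.lookup f v * word_counit v * (Poly_Mapping.lookup g w * word_counit w))"
    by (simp add: free_counit_sum mult_ac)
  also have "\<dots> = free_counit f * free_counit g"
    by (simp add: free_counit_def sum_product)
  finally show ?thesis .
qed

lemma free_counit_1 [simp]: "free_counit 1 = 1"
  by (simp add: word_counit_def zero_uword_def flip: single_one)

lemma free_counit_urelators: "r \<in> urelators \<Longrightarrow> free_counit r = 0"
  by (auto simp: urelators_def free_counit_diff free_counit_mult free_gen_def word_counit_def)

lemma free_counit_uideal: "x \<in> uideal \<Longrightarrow> free_counit x = 0"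
  by (induction rule: uideal.induct)
     (simp_all add: free_counit_add free_counit_mult free_counit_urelators)


section \<open>The quantum group\<close>

definition urel :: "ufree \<Rightarrow> ufree \<Rightarrow> bool" where
  "urel x y \<longleftrightarrow> x - y \<in> uideal"

lemma equivp_urel: "equivp urel"
proof (intro equivpI reflpI sympI transpI)
  show "urel x x" for x
    by (simp add: urel_def uideal.zero)
  show "urel y x" if "urel x y" for x y
    using uideal_uminus[of "x - y"] that by (simp add: urel_def)
  show "urel x z" if "urel x y" "urel y z" for x y z
    using uideal.add[of "x - y" "y - z"] that by (simp add: urel_def)
qed

quotient_type Uq = ufree / urel
  by (rule equivp_urel)

instantiation Uq :: ring_1
begin

lift_definition zero_Uq :: Uq is 0 .

lift_definition one_Uq :: Uq is 1 .

lift_definition plus_Uq :: "Uq \<Rightarrow> Uq \<Rightarrow> Uq" is "(+)"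
proof -
  fix x x' y y' assume "urel x x'" "urel y y'"
  then show "urel (x + y) (x' + y')"
    using uideal.add[of "x - x'" "y - y'"] by (simp add: urel_def add_diff_add)
qed

lift_definition uminus_Uq :: "Uq \<Rightarrow> Uq" is uminus
proof -
  fix x x' assume "urel x x'"
  then show "urel (- x) (- x')"
    using uideal_uminus[of "x - x'"] by (simp add: urel_def algebra_simps)
qed

lift_definition minus_Uq :: "Uq \<Rightarrow> Uq \<Rightarrow> Uq" is "(-)"
proof -
  fix x x' y y' assume "urel x x'" "urel y y'"
  then show "urel (x - y) (x' - y')"
    using uideal_diff[of "x - x'" "y - y'"] by (simp add: urel_def algebra_simps)
qed

lift_definition times_Uq :: "Uq \<Rightarrow> Uq \<Rightarrow> Uq" is "(*)"
proof -
  fix x x' y y' assume "urel x x'" "urel y y'"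
  then have "(x - x') * y + x' * (y - y') \<in> uideal"
    by (auto simp: urel_def intro: uideal.add uideal_mult_left uideal_mult_right)
  then show "urel (x * y) (x' * y')"
    by (simp add: urel_def algebra_simps)
qed

instance
proof
  show "(0 :: Uq) \<noteq> 1"
  proof transfer
    show "\<not> urel 0 1"
      using free_counit_uideal[of "- 1"] free_counit_diff[of 0 1] by (auto simp: urel_def)
  qed
qed (transfer; simp add: urel_def uideal.zero algebra_simps)+

end

lift_definition U_scalar :: "qrat \<Rightarrow> Uq" is free_scalar .

definition U_scale :: "qrat \<Rightarrow> Uq \<Rightarrow> Uq"  (infixr "*\<^sub>q" 75) where
  "c *\<^sub>q x = U_scalar c * x"

lift_definition U_E :: Uq is "free_gen GenE" .
lift_definition U_F :: Uq is "free_gen GenF" .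
lift_definition U_K :: Uq is "free_gen GenK" .
lift_definition U_Kinv :: Uq is "free_gen GenKinv" .

lemma U_relations:
  "U_K * U_Kinv = 1"
  "U_Kinv * U_K = 1"
  "U_E * U_F - U_F * U_E = (1 / (q - q powi (-1))) *\<^sub>q (U_K - U_Kinv)"
  "U_K * U_E = q ^ 2 *\<^sub>q (U_E * U_K)"
  "U_K * U_F = q powi (-2) *\<^sub>q (U_F * U_K)"
  unfolding U_scale_def
  by (transfer; simp add: urel_def urelators_uideal urelators_def)+

lemma free_scalar_commute: "free_scalar c * f = f * free_scalar c"
  by (subst (1 2) ufree_monomials[of f])
     (simp add: free_scalar_def sum_distrib_left sum_distrib_right mult_single mult.commute)

lemma U_scalar_commute: "U_scalar c * x = x * U_scalar c"
  by transfer (simp add: free_scalar_commute urel_def uideal.zero)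

lemma U_scalar_hom:
  "U_scalar 0 = 0"
  "U_scalar 1 = 1"
  "U_scalar (b + c) = U_scalar b + U_scalar c"
  "U_scalar (b * c) = U_scalar b * U_scalar c"
  by (transfer; simp add: urel_def uideal.zero free_scalar_def single_add mult_single)+

interpretation U_vs: vector_space U_scale
  by standard (simp_all add: U_scale_def U_scalar_hom algebra_simps)

lemma U_scale_mult_left: "(c *\<^sub>q x) * y = c *\<^sub>q (x * y)"
  by (simp add: U_scale_def mult.assoc)

lemma U_scale_mult_right: "x * (c *\<^sub>q y) = c *\<^sub>q (x * y)"
proof -
  have "x * (U_scalar c * y) = (x * U_scalar c) * y" by (simp only: mult.assoc)
  also have "\<dots> = U_scalar c * (x * y)" by (simp only: U_scalar_commute[symmetric] mult.assoc)
  finally show ?thesis by (simp only: U_scale_def)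
qed


section \<open>The elements of the identities\<close>

definition Echeck :: Uq where
  "Echeck = q powi (-1) *\<^sub>q (U_E * U_Kinv)"

definition tt :: Uq where
  "tt = Echeck + U_F"

definition divpow :: "Uq \<Rightarrow> nat \<Rightarrow> Uq" where
  "divpow x n = (1 / qfact n) *\<^sub>q x ^ n"

text \<open>The factors commute, so that the order of the list product is immaterial.\<close>
definition hbrace :: "int \<Rightarrow> nat \<Rightarrow> Uq" where
  "hbrace a n =
    (\<Prod>i\<leftarrow>[1..int n]. (1 / (q powi (4 * i) - 1)) *\<^sub>q
       (q powi (4 * a + 4 * i - 4) *\<^sub>q U_Kinv ^ 2 - q ^ 2 *\<^sub>q 1))"

definition tt_odd :: "nat \<Rightarrow> Uq" where
  "tt_odd n =
    (let a = int (n div 2) in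
     (1 / qfact n) *\<^sub>q
       ((if odd n then tt else 1) * (\<Prod>i\<leftarrow>[1 - a..a]. tt - qint (2 * i - 1) *\<^sub>q 1)))"

lemma tt_odd_even_index:
  "tt_odd (2 * a) =
    (1 / qfact (2 * a)) *\<^sub>q (\<Prod>i\<leftarrow>[1 - int a..int a]. tt - qint (2 * i - 1) *\<^sub>q 1)"
  by (simp add: tt_odd_def Let_def)

lemma tt_odd_odd_index:
  "tt_odd (2 * a + 1) =
    (1 / qfact (2 * a + 1)) *\<^sub>q
      (tt * (\<Prod>i\<leftarrow>[1 - int a..int a]. tt - qint (2 * i - 1) *\<^sub>q 1))"
  by (simp add: tt_odd_def Let_def)

end

theory Submission
  imports Defs
begin

text \<open>
  Both families in the theorem are determined by a recursion under left multiplication by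
  \<open>tt = Echeck + F\<close>. For the left-hand sides it is
  \<open>tt * tt_odd (2m) = [2m + 1] tt_odd (2m + 1)\<close> and
  \<open>tt * tt_odd (2m + 1) = [2m + 2] tt_odd (2m + 2) + [2m + 1] tt_odd (2m)\<close>
  (\<open>tt_mult_tt_odd_even\<close>, \<open>tt_mult_tt_odd_odd\<close>). As quantum integers of positive index are
  invertible, it suffices that the right-hand sides satisfy the same recursion
  (\<open>normal_sum_odd_step\<close>, \<open>normal_sum_even_step\<close>) with the same initial value \<open>1\<close>.

  The right-hand sides are sums of normally ordered products, a divided power of \<open>Echeck\<close> times a
  polynomial in \<open>U_Kinv\<^sup>2\<close> times a divided power of \<open>F\<close>. Multiplication by \<open>Echeck\<close> only raises the
  first exponent. The factor \<open>F\<close> has to move to the right. Past a divided power of \<open>Echeck\<close> it leaves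
  a correction term of degree one in \<open>U_Kinv\<^sup>2\<close> (\<open>F_divpow_Echeck\<close>), and past \<open>hbrace a c\<close> it lowers
  \<open>a\<close> by one (\<open>F_hbrace\<close>). The product is therefore again a normally ordered sum
  (\<open>tt_mult_normal_sum\<close>), and the recursion can be checked one index at a time.

  For an index with \<open>c > 0\<close> the claim is a linear relation between \<open>hbrace (1 - m) c\<close>, \<open>hbrace (- m) c\<close> and a
  multiple of \<open>hbrace (1 - m) (c - 1)\<close>. The key observation is that the first two are multiples of the
  third by a factor of degree one in \<open>U_Kinv\<^sup>2\<close> (\<open>hbrace_Suc\<close>, \<open>hbrace_Suc_lower\<close>). So the claim
  amounts to the equality of two coefficients, which are rational functions of \<open>q\<close> and its powers to \<open>a\<close>, \<open>b\<close>, \<open>c\<close>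
  (\<open>middle_factor_odd\<close>, \<open>middle_factor_even\<close>).
\<close>


section \<open>The field and its quantum integers\<close>

lemma q_power_eq_Fract: "q ^ n = Fract (monom 1 n) 1"
  by (induction n) (simp_all add: q_def One_fract_def monom_Suc mult.commute flip: one_pCons)

lemma q_neq_0 [simp]: "q \<noteq> 0"
  by (simp add: q_def Zero_fract_def eq_fract)

lemma q_power_eq_1_iff: "q ^ n = 1 \<longleftrightarrow> n = 0"
proof
  assume "q ^ n = 1"
  then have "monom (1 :: rat) n = 1"
    by (simp add: q_power_eq_Fract One_fract_def eq_fract)
  then have "degree (monom (1 :: rat) n) = 0" by simp
  then show "n = 0" by (simp add: degree_monom_eq)
qed simp

lemma q_powi_add: "q powi (i + j) = q powi i * q powi j"
  by (simp add: power_int_add)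

lemma q_powi_numeral_mult: "q powi (numeral k * n) = (q powi n) ^ numeral k"
  by (metis mult.commute power_int_mult power_int_numeral)

text \<open>Since \<open>q\<close> is an indeterminate, hence not a root of unity, all the
denominators of the identities are nonzero.\<close>

lemma q_powi_eq_1_iff: "q powi n = 1 \<longleftrightarrow> n = 0"
  by (cases "0 \<le> n") (auto simp: power_int_def q_power_eq_1_iff power_inverse)

lemma q_square_neq_1 [simp]: "q\<^sup>2 \<noteq> 1"
  by (simp add: q_power_eq_1_iff)

text \<open>The denominator \<open>q\<^sup>2 - 1\<close> is the one that occurs in
\<open>h\<close>, so that coefficients can be compared over a common denominator.\<close>

lemma qint_eq: "qint n = q * (q powi n - inverse (q powi n)) / (q\<^sup>2 - 1)"
proof -
  have "q - q powi (-1) = (q\<^sup>2 - 1) / q"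
    by (simp add: power_int_minus field_simps power2_eq_square)
  then show ?thesis by (simp add: qint_def power_int_minus mult.commute)
qed

lemma qint_0 [simp]: "qint 0 = 0"
  by (simp add: qint_def)

lemma qint_1 [simp]: "qint 1 = 1"
proof -
  have "q\<^sup>2 - 1 \<noteq> 0" by simp
  then show ?thesis by (simp add: qint_eq field_simps power2_eq_square)
qed

lemma qint_uminus: "qint (- n) = - qint n"
  by (simp add: qint_eq power_int_minus algebra_simps diff_divide_distrib)

lemma qint_neq_0: "n \<noteq> 0 \<Longrightarrow> qint n \<noteq> 0"
proof
  assume n: "n \<noteq> 0" and "qint n = 0"
  then have "q powi n = inverse (q powi n)"
    by (simp add: qint_eq)
  then have "q powi n * q powi n = 1"
    by (simp add: field_simps)
  then have "q powi (n + n) = 1"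
    by (simp only: power_int_add q_neq_0 simp_thms)
  then show False using n by (simp add: q_powi_eq_1_iff)
qed

text \<open>The addition rule for quantum integers. It settles the case \<open>c = 0\<close> of
the coefficient comparison and the induction step for \<open>F Echeck\<^sup>n\<close>.\<close>

lemma qint_add: "q powi n * qint m + q powi (- m) * qint n = qint (m + n)"
proof -
  define r where "r = q / (q\<^sup>2 - 1)"
  have r: "qint k = r * (q powi k - inverse (q powi k))" for k
    by (simp add: qint_eq r_def)
  show ?thesis
    by (simp add: r power_int_add power_int_minus algebra_simps)
qed

lemma qfact_0 [simp]: "qfact 0 = 1"
  by (simp add: qfact_def)

lemma qfact_Suc: "qfact (Suc n) = qint (int n + 1) * qfact n"
  by (simp add: qfact_def prod.nat_ivl_Suc' add.commute)

lemma qfact_neq_0 [simp]: "qfact n \<noteq> 0"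
  by (simp add: qfact_def qint_neq_0)


section \<open>Commutation with the torus part\<close>

lemmas U_scale_simps = U_scale_mult_left U_scale_mult_right
  U_vs.scale_right_distrib U_vs.scale_right_diff_distrib

lemma F_Kinv: "U_F * U_Kinv = q powi (-2) *\<^sub>q (U_Kinv * U_F)"
proof -
  have "U_F * U_Kinv = U_Kinv * (U_K * U_F) * U_Kinv"
    by (metis U_relations(2) mult.assoc mult_1_left)
  also have "\<dots> = q powi (-2) *\<^sub>q (U_Kinv * U_F * (U_K * U_Kinv))"
    by (simp only: U_relations(5) U_scale_simps mult.assoc)
  finally show ?thesis by (simp only: U_relations(1) mult_1_right)
qed

lemma Kinv_E: "U_Kinv * U_E = q powi (-2) *\<^sub>q (U_E * U_Kinv)"
proof -
  have "U_E * U_Kinv = U_Kinv * (U_K * U_E) * U_Kinv"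
    by (metis U_relations(2) mult.assoc mult_1_left)
  also have "\<dots> = q\<^sup>2 *\<^sub>q (U_Kinv * U_E * (U_K * U_Kinv))"
    by (simp only: U_relations(4) U_scale_simps mult.assoc)
  finally have "U_E * U_Kinv = q\<^sup>2 *\<^sub>q (U_Kinv * U_E)"
    by (simp only: U_relations(1) mult_1_right)
  then show ?thesis
    by (simp add: power_int_minus)
qed

lemma Kinv_Echeck: "U_Kinv * Echeck = q powi (-2) *\<^sub>q (Echeck * U_Kinv)"
proof -
  have "U_Kinv * Echeck = q powi (-1) *\<^sub>q (U_Kinv * U_E * U_Kinv)"
    by (simp only: Echeck_def U_scale_simps mult.assoc)
  then show ?thesis
    by (simp add: Kinv_E Echeck_def U_scale_simps mult.commute mult.assoc)
qed

text \<open>The polynomials of degree at most one in \<open>U_Kinv\<^sup>2\<close>. All elements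
of the torus part met below are products of these, and two products that share all but one factor
can be compared through the two coefficients of the remaining factor.\<close>

definition Kaff :: "qrat \<Rightarrow> qrat \<Rightarrow> Uq" where
  "Kaff x y = x *\<^sub>q U_Kinv ^ 2 + y *\<^sub>q 1"

lemma Kaff_scale: "s *\<^sub>q Kaff x y = Kaff (s * x) (s * y)"
  by (simp add: Kaff_def U_scale_simps)

lemma Kaff_add: "Kaff x y + Kaff x' y' = Kaff (x + x') (y + y')"
  by (simp add: Kaff_def U_vs.scale_left_distrib)

lemma Kaff_combination:
  "u *\<^sub>q Kaff (x / d) (y / d) + v *\<^sub>q Kaff (x' / d) (y' / d)
     = Kaff ((u * x + v * x') / d) ((u * y + v * y') / d)"
  by (simp add: Kaff_scale Kaff_add add_divide_distrib)

lemma Kaff_collect: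
  "u *\<^sub>q (Kaff a b * B) + v *\<^sub>q (Kaff a' b' * B) + w *\<^sub>q (Kaff a'' b'' * B)
     = Kaff (u * a + v * a' + w * a'') (u * b + v * b' + w * b'') * B"
  by (simp add: Kaff_scale Kaff_add flip: U_scale_mult_left distrib_right)

lemma Kaff_commute: "Kaff x y * Kaff x' y' = Kaff x' y' * Kaff x y"
  by (simp add: Kaff_def U_scale_simps distrib_left distrib_right mult.commute add_ac)

lemma Kaff_Echeck: "Kaff x y * Echeck = Echeck * Kaff (q powi (-4) * x) y"
proof -
  have "U_Kinv ^ 2 * Echeck = U_Kinv * (U_Kinv * Echeck)"
    by (simp add: power2_eq_square mult.assoc)
  also have "\<dots> = U_Kinv * (q powi (-2) *\<^sub>q (Echeck * U_Kinv))"
    by (simp only: Kinv_Echeck)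
  also have "\<dots> = q powi (-2) *\<^sub>q ((U_Kinv * Echeck) * U_Kinv)"
    by (simp only: U_scale_simps mult.assoc)
  also have "\<dots> = (q powi (-2) * q powi (-2)) *\<^sub>q (Echeck * U_Kinv ^ 2)"
    unfolding Kinv_Echeck by (simp only: U_scale_simps U_vs.scale_scale mult.assoc power2_eq_square)
  finally have "U_Kinv ^ 2 * Echeck = q powi (-4) *\<^sub>q (Echeck * U_Kinv ^ 2)"
    by (simp flip: power_int_add)
  then show ?thesis
    by (simp add: Kaff_def distrib_left distrib_right U_scale_simps mult.commute)
qed

lemma F_Kaff: "U_F * Kaff x y = Kaff (q powi (-4) * x) y * U_F"
proof -
  have "U_F * U_Kinv ^ 2 = U_F * U_Kinv * U_Kinv"
    by (simp add: power2_eq_square mult.assoc)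
  also have "\<dots> = q powi (-2) *\<^sub>q (U_Kinv * (U_F * U_Kinv))"
    by (simp only: F_Kinv U_scale_simps mult.assoc)
  also have "\<dots> = (q powi (-2) * q powi (-2)) *\<^sub>q (U_Kinv ^ 2 * U_F)"
    by (simp only: F_Kinv U_scale_simps U_vs.scale_scale mult.assoc power2_eq_square)
  finally have "U_F * U_Kinv ^ 2 = q powi (-4) *\<^sub>q (U_Kinv ^ 2 * U_F)"
    by (simp flip: power_int_add)
  then show ?thesis
    by (simp add: Kaff_def distrib_left distrib_right U_scale_simps mult.commute)
qed


section \<open>Commutation of \<open>F\<close> with divided powers\<close>

text \<open>The commutator relation of \<open>E\<close> and \<open>F\<close> becomes a
\<open>q\<close>-commutation of \<open>F\<close> and \<open>Echeck\<close>, whose correction term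
is the element \<open>h\<close>, of degree one in \<open>U_Kinv\<^sup>2\<close>.\<close>

lemma F_Echeck:
  "U_F * Echeck = q powi (-2) *\<^sub>q (Echeck * U_F) + Kaff (1 / (q\<^sup>2 - 1)) (- 1 / (q\<^sup>2 - 1))"
proof -
  define d where "d = 1 / (q - q powi (-1))"
  have d: "q powi (-1) * d = 1 / (q\<^sup>2 - 1)"
    by (simp add: d_def power_int_minus field_simps power2_eq_square)
  have FE: "U_F * U_E = U_E * U_F - d *\<^sub>q (U_K - U_Kinv)"
    using U_relations(3) by (simp add: d_def algebra_simps)
  have "U_F * Echeck = q powi (-1) *\<^sub>q (U_F * U_E * U_Kinv)"
    by (simp only: Echeck_def U_scale_simps mult.assoc)
  also have "\<dots> = q powi (-1) *\<^sub>q (U_E * (U_F * U_Kinv)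
      - d *\<^sub>q (U_K * U_Kinv - U_Kinv ^ 2))"
    by (simp only: FE left_diff_distrib U_scale_simps mult.assoc power2_eq_square)
  also have "\<dots> = q powi (-1) *\<^sub>q (q powi (-2) *\<^sub>q (U_E * U_Kinv * U_F)
      - d *\<^sub>q (1 - U_Kinv ^ 2))"
    by (simp only: F_Kinv U_relations(1) U_scale_simps mult.assoc)
  also have "\<dots> = q powi (-2) *\<^sub>q (Echeck * U_F)
      - (q powi (-1) * d) *\<^sub>q (1 - U_Kinv ^ 2)"
    by (simp add: Echeck_def U_scale_simps mult.commute)
  finally show ?thesis
    unfolding d by (simp add: Kaff_def U_scale_simps)
qed

text \<open>Moving \<open>F\<close> past each of the \<open>n + 1\<close> letters leaves
\<open>h\<close> at every position \<open>j\<close>; bringing \<open>h\<close> to the right of the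
remaining letters rescales \<open>U_Kinv\<^sup>2\<close> by a power of \<open>q\<close>, and both
geometric sums over \<open>j\<close> yield the factor \<open>[n + 1]\<close>. That factor cancels
when passing to divided powers.\<close>

lemma F_Echeck_power:
  "U_F * Echeck ^ Suc n = q powi (- 2 * int n - 2) *\<^sub>q (Echeck ^ Suc n * U_F)
     + qint (int n + 1) *\<^sub>q (Echeck ^ n *
         Kaff (q powi (- 3 * int n) / (q\<^sup>2 - 1)) (- (q powi (- int n)) / (q\<^sup>2 - 1)))"
proof (induction n)
  case 0
  show ?case by (simp add: F_Echeck)
next
  case (Suc n)
  define L where "L = Kaff (1 / (q\<^sup>2 - 1)) (- 1 / (q\<^sup>2 - 1))"
  have "U_F * Echeck ^ Suc (Suc n) = U_F * Echeck ^ Suc n * Echeck"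
    by (simp only: power_Suc2 mult.assoc)
  also have "\<dots> = q powi (- 2 * int n - 2) *\<^sub>q (Echeck ^ Suc n * (U_F * Echeck))
     + qint (int n + 1) *\<^sub>q (Echeck ^ n * (
         Kaff (q powi (- 3 * int n) / (q\<^sup>2 - 1)) (- (q powi (- int n)) / (q\<^sup>2 - 1)) * Echeck))"
    by (simp only: Suc distrib_right U_scale_mult_left mult.assoc)
  also have "\<dots> = (q powi (- 2 * int n - 2) * q powi (-2)) *\<^sub>q (Echeck ^ Suc (Suc n) * U_F)
     + Echeck ^ Suc n * (q powi (- 2 * int n - 2) *\<^sub>q L + qint (int n + 1) *\<^sub>q
         Kaff (q powi (-4) * (q powi (- 3 * int n) / (q\<^sup>2 - 1))) (- (q powi (- int n)) / (q\<^sup>2 - 1)))"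
    by (simp only: F_Echeck Kaff_Echeck L_def distrib_left U_scale_simps U_vs.scale_scale
        mult.assoc power_Suc2 add.assoc)
  also have "q powi (- 2 * int n - 2) *\<^sub>q L + qint (int n + 1) *\<^sub>q
         Kaff (q powi (-4) * (q powi (- 3 * int n) / (q\<^sup>2 - 1))) (- (q powi (- int n)) / (q\<^sup>2 - 1))
     = qint (int n + 2) *\<^sub>q
         Kaff (q powi (- 3 * int n - 3) / (q\<^sup>2 - 1)) (- (q powi (- int n - 1)) / (q\<^sup>2 - 1))"
  proof -
    \<comment> \<open>Both coefficients are instances of \<open>qint_add\<close> for \<open>[n + 2]\<close>, with \<open>[1] = 1\<close>, up to a power
       of \<open>q\<close>.\<close>
    have "q powi (- 2 * int n - 2) + qint (int n + 1) * q powi (-4 - 3 * int n)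
        = q powi (- 3 * int n - 3) * (q powi (int n + 1) * qint 1 + q powi (-1) * qint (int n + 1))"
      by (simp only: distrib_left qint_1 mult_1_right mult.assoc [symmetric] q_powi_add [symmetric])
         (simp add: mult.commute)
    also have "\<dots> = qint (int n + 2) * q powi (- 3 * int n - 3)"
      by (simp only: qint_add) (simp add: add.commute)
    finally have 1: "q powi (- 2 * int n - 2) + qint (int n + 1) * q powi (-4 - 3 * int n)
        = qint (int n + 2) * q powi (- 3 * int n - 3)" .
    have "q powi (- 2 * int n - 2) + qint (int n + 1) * q powi (- int n)
        = q powi (- int n - 1) * (q powi 1 * qint (int n + 1) + q powi (- (int n + 1)) * qint 1)"
      by (simp only: distrib_left qint_1 mult_1_right mult.assoc [symmetric] q_powi_add [symmetric])
         (simp add: mult.commute)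
    also have "\<dots> = qint (int n + 2) * q powi (- int n - 1)"
      by (simp only: qint_add) (simp add: add.commute)
    finally have 2: "q powi (- 2 * int n - 2) + qint (int n + 1) * q powi (- int n)
        = qint (int n + 2) * q powi (- int n - 1)" .
    have "q powi (-4) * q powi (- 3 * int n) = q powi (-4 - 3 * int n)"
      by (simp flip: power_int_add)
    with 1 have 3: "q powi (- 2 * int n - 2) * 1 + qint (int n + 1) * (q powi (-4) * q powi (- 3 * int n))
        = qint (int n + 2) * q powi (- 3 * int n - 3)"
      by simp
    have 4: "q powi (- 2 * int n - 2) * -1 + qint (int n + 1) * - (q powi (- int n))
        = qint (int n + 2) * - (q powi (- int n - 1))"
      using 2 by algebra
    show ?thesis
      unfolding L_def times_divide_eq_right Kaff_combination 3 4 by (simp only: Kaff_scale times_divide_eq_right)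
  qed
  finally have *: "U_F * Echeck ^ Suc (Suc n)
      = (q powi (- 2 * int n - 2) * q powi (-2)) *\<^sub>q (Echeck ^ Suc (Suc n) * U_F)
      + Echeck ^ Suc n * qint (int n + 2) *\<^sub>q
         Kaff (q powi (- 3 * int n - 3) / (q\<^sup>2 - 1)) (- (q powi (- int n - 1)) / (q\<^sup>2 - 1))" .
  have e: "- 2 * int (Suc n) - 2 = (- 2 * int n - 2) + (-2)" "int (Suc n) + 1 = int n + 2"
    "- 3 * int (Suc n) = - 3 * int n - 3" "- int (Suc n) = - int n - 1"
    by simp_all
  show ?case
    unfolding * e q_powi_add U_scale_mult_right ..
qed

lemma mult_divpow: "x * divpow x n = qint (int n + 1) *\<^sub>q divpow x (Suc n)"
  by (simp add: divpow_def qfact_Suc U_scale_simps qint_neq_0)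

text \<open>The torus factor that remains when \<open>F\<close> moves past the divided power
\<open>divpow Echeck (a + 1)\<close>.\<close>

definition F_bracket :: "nat \<Rightarrow> Uq" where
  "F_bracket a = Kaff (q powi (- 3 * int a) / (q\<^sup>2 - 1)) (- (q powi (- int a)) / (q\<^sup>2 - 1))"

lemma F_divpow_Echeck:
  "U_F * divpow Echeck (Suc n) = q powi (- 2 * int n - 2) *\<^sub>q (divpow Echeck (Suc n) * U_F)
     + divpow Echeck n * F_bracket n"
proof -
  have "U_F * divpow Echeck (Suc n) = (1 / qfact (Suc n)) *\<^sub>q (U_F * Echeck ^ Suc n)"
    by (simp only: divpow_def U_scale_simps)
  then show ?thesis
    unfolding F_Echeck_power F_bracket_def
    by (simp add: divpow_def qfact_Suc U_scale_simps qint_neq_0 mult.commute del: power_Suc)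
qed


section \<open>The braces\<close>

lemma commute_prod_list:
  fixes y :: "'a :: monoid_mult"
  assumes "\<And>x. x \<in> set xs \<Longrightarrow> y * x = x * y"
  shows "y * prod_list xs = prod_list xs * y"
  using assms
proof (induction xs)
  case (Cons x xs)
  have "y * (x * prod_list xs) = x * (y * prod_list xs)"
    using Cons.prems [of x] by (simp flip: mult.assoc)
  then show ?case using Cons by (simp add: mult.assoc)
qed simp

lemma hbrace_0 [simp]: "hbrace a 0 = 1"
  by (simp add: hbrace_def)

lemma hbrace_Suc:
  "hbrace a (Suc n) = Kaff (q powi (4 * a + 4 * int n) / (q powi (4 * int n + 4) - 1))
     (- (q ^ 2) / (q powi (4 * int n + 4) - 1)) * hbrace a n"
proof -
  define f where "f i = Kaff (q powi (4 * a + 4 * i - 4) / (q powi (4 * i) - 1))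
     (- (q ^ 2) / (q powi (4 * i) - 1))" for i
  have hb: "hbrace a k = (\<Prod>i\<leftarrow>[1..int k]. f i)" for k
    unfolding hbrace_def f_def
    by (intro arg_cong [where f = prod_list] map_cong refl)
       (simp add: Kaff_def U_scale_simps)
  have "f i * hbrace a k = hbrace a k * f i" for i k
    unfolding hb by (rule commute_prod_list) (auto simp: f_def intro: Kaff_commute)
  moreover have "hbrace a (Suc n) = hbrace a n * f (int n + 1)"
    by (simp add: hb upto_rec2 add.commute)
  ultimately have "hbrace a (Suc n) = f (int n + 1) * hbrace a n" by simp
  moreover have "4 * a + 4 * (int n + 1) - 4 = 4 * a + 4 * int n" "4 * (int n + 1) = 4 * int n + 4"
    by simp_all
  ultimately show ?thesis by (simp only: f_def)
qed

text \<open>Lowering \<open>a\<close> by one shifts the numerators of the product by one place and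
leaves the denominators alone. So the products for \<open>a\<close> and \<open>a - 1\<close> of
length \<open>n + 1\<close> are both multiples of the one for \<open>a\<close> of length
\<open>n\<close>: the former adds a numerator at the end (the lemma above), the latter at the
beginning.\<close>

lemma hbrace_Suc_lower:
  "hbrace (a - 1) (Suc n) = Kaff (q powi (4 * a - 4) / (q powi (4 * int n + 4) - 1))
     (- (q ^ 2) / (q powi (4 * int n + 4) - 1)) * hbrace a n"
proof (induction n)
  case 0
  then show ?case by (simp add: hbrace_Suc right_diff_distrib)
next
  case (Suc n)
  define s t where "s = 1 / (q powi (4 * int n + 8) - 1)" and "t = 1 / (q powi (4 * int n + 4) - 1)"
  define P R where "P = Kaff (q powi (4 * a + 4 * int n)) (- (q\<^sup>2))"
    and "R = Kaff (q powi (4 * a - 4)) (- (q\<^sup>2))"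
  have sP: "s *\<^sub>q P = Kaff (q powi (4 * a + 4 * int n) / (q powi (4 * int n + 8) - 1))
     (- (q\<^sup>2) / (q powi (4 * int n + 8) - 1))"
    by (simp add: s_def P_def Kaff_scale)
  have tP: "t *\<^sub>q P = Kaff (q powi (4 * a + 4 * int n) / (q powi (4 * int n + 4) - 1))
     (- (q\<^sup>2) / (q powi (4 * int n + 4) - 1))"
    by (simp add: t_def P_def Kaff_scale)
  have sR: "s *\<^sub>q R = Kaff (q powi (4 * a - 4) / (q powi (4 * int n + 8) - 1))
     (- (q\<^sup>2) / (q powi (4 * int n + 8) - 1))"
    by (simp add: s_def R_def Kaff_scale)
  have tR: "t *\<^sub>q R = Kaff (q powi (4 * a - 4) / (q powi (4 * int n + 4) - 1))
     (- (q\<^sup>2) / (q powi (4 * int n + 4) - 1))"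
    by (simp add: t_def R_def Kaff_scale)
  have e: "4 * (a - 1) + 4 * int (Suc n) = 4 * a + 4 * int n" "4 * int (Suc n) + 4 = 4 * int n + 8"
    by simp_all
  have PR: "P * (R * h) = R * (P * h)" for h
    by (simp add: P_def R_def Kaff_commute flip: mult.assoc)
  \<comment> \<open>The numerator \<open>P\<close> at the end and the numerator \<open>R\<close> at the beginning trade places, while the
     denominators \<open>s\<close> and \<open>t\<close> stay.\<close>
  have "hbrace (a - 1) (Suc (Suc n)) = s *\<^sub>q P * hbrace (a - 1) (Suc n)"
    unfolding hbrace_Suc [of "a - 1" "Suc n"] e sP ..
  also have "\<dots> = s *\<^sub>q P * (t *\<^sub>q R * hbrace a n)"
    unfolding Suc tR ..
  also have "\<dots> = s *\<^sub>q R * (t *\<^sub>q P * hbrace a n)"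
    by (simp add: U_scale_simps PR)
  also have "t *\<^sub>q P * hbrace a n = hbrace a (Suc n)"
    unfolding hbrace_Suc tP ..
  finally show ?case
    unfolding e sR .
qed

text \<open>Moving \<open>F\<close> to the right substitutes \<open>q powi (-4) *\<^sub>q
U_Kinv\<^sup>2\<close> for \<open>U_Kinv\<^sup>2\<close>, which in the product amounts to lowering
\<open>a\<close>.\<close>

lemma F_hbrace: "U_F * hbrace a n = hbrace (a - 1) n * U_F"
proof (induction n)
  case (Suc n)
  have "U_F * hbrace a (Suc n) = Kaff (q powi (-4) * (q powi (4 * a + 4 * int n) / (q powi (4 * int n + 4) - 1)))
     (- (q ^ 2) / (q powi (4 * int n + 4) - 1)) * (U_F * hbrace a n)"
    by (simp only: hbrace_Suc F_Kaff mult.assoc [symmetric])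
  also have "q powi (-4) * (q powi (4 * a + 4 * int n) / (q powi (4 * int n + 4) - 1))
     = q powi (4 * (a - 1) + 4 * int n) / (q powi (4 * int n + 4) - 1)"
    by (simp add: algebra_simps flip: q_powi_add)
  finally show ?case
    by (simp only: hbrace_Suc [of "a - 1"] Suc mult.assoc)
qed simp

lemma F_hbrace_shift: "U_F * hbrace (1 - int m) c = hbrace (- int m) c * U_F"
  using F_hbrace [of "1 - int m" c] by simp

text \<open>In the term of index \<open>c = d + 1\<close> the weight condition eliminates
\<open>m\<close>: the power \<open>q powi (4 * (c - m))\<close> is determined by \<open>a\<close>,
\<open>b\<close> and \<open>k\<close>. Thus everything becomes a rational function of
\<open>q\<close>, \<open>x\<close>, \<open>y\<close>, \<open>z\<close>, the powers of
\<open>q\<close> to \<open>a\<close>, \<open>b\<close>, \<open>c\<close>.\<close>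

lemma hbrace_Kaff:
  fixes m d a b :: nat
  assumes "2 * Suc d + a + b = 2 * m + k"
  defines "x \<equiv> q powi int a" and "y \<equiv> q powi int b" and "z \<equiv> q powi int (Suc d)"
  defines "P \<equiv> q ^ (2 * k) / (x\<^sup>2 * y\<^sup>2)"
  shows "hbrace (1 - int m) (Suc d)
      = Kaff (P / (z ^ 4 - 1)) (- (q\<^sup>2) / (z ^ 4 - 1)) * hbrace (1 - int m) d"
    and "hbrace (- int m) (Suc d)
      = Kaff (P / z ^ 4 / (z ^ 4 - 1)) (- (q\<^sup>2) / (z ^ 4 - 1)) * hbrace (1 - int m) d"
proof -
  have z: "q powi (4 * int d + 4) = z ^ 4"
    unfolding z_def q_powi_numeral_mult [symmetric] by (simp add: algebra_simps)
  have "4 * (1 - int m) + 4 * int d = 2 * int k - (2 * int a + 2 * int b)"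
    using arg_cong [OF assms(1), of int] by simp
  then have P: "q powi (4 * (1 - int m) + 4 * int d) = P"
    unfolding P_def x_def y_def
    by (simp only: power_int_diff q_neq_0 simp_thms q_powi_add q_powi_numeral_mult)
       (simp add: power_mult power_int_power mult.commute)
  have "4 * (1 - int m) - 4 = (4 * (1 - int m) + 4 * int d) - (4 * int d + 4)"
    by simp
  then have P': "q powi (4 * (1 - int m) - 4) = P / z ^ 4"
    by (simp only: power_int_diff q_neq_0 simp_thms P z)
  show "hbrace (1 - int m) (Suc d)
      = Kaff (P / (z ^ 4 - 1)) (- (q\<^sup>2) / (z ^ 4 - 1)) * hbrace (1 - int m) d"
    unfolding hbrace_Suc P z ..
  show "hbrace (- int m) (Suc d)
      = Kaff (P / z ^ 4 / (z ^ 4 - 1)) (- (q\<^sup>2) / (z ^ 4 - 1)) * hbrace (1 - int m) d"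
    using hbrace_Suc_lower [of "1 - int m" d] unfolding P' z by simp
qed


section \<open>Left multiplication of normally ordered sums\<close>

text \<open>The term with \<open>h'\<close> and the one with \<open>F_bracket\<close> come from
\<open>F\<close> moving past \<open>divpow Echeck a\<close>. In the former \<open>F\<close> moves
on past \<open>h\<close> and joins the power of \<open>F\<close>; in the latter it has been
absorbed.\<close>

lemma tt_mult_monomial:
  assumes "U_F * h = h' * U_F"
  shows "tt * (divpow Echeck a * h * divpow U_F b) =
      qint (int a + 1) *\<^sub>q (divpow Echeck (Suc a) * h * divpow U_F b)
    + (q powi (- 2 * int a) * qint (int b + 1)) *\<^sub>q (divpow Echeck a * h' * divpow U_F (Suc b))
    + (if a = 0 then 0 else divpow Echeck (a - 1) * (F_bracket (a - 1) * h) * divpow U_F b)"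
proof -
  have E: "Echeck * (divpow Echeck a * h * divpow U_F b)
      = qint (int a + 1) *\<^sub>q (divpow Echeck (Suc a) * h * divpow U_F b)"
    by (simp add: mult_divpow U_scale_simps flip: mult.assoc)
  have F: "U_F * divpow Echeck a = q powi (- 2 * int a) *\<^sub>q (divpow Echeck a * U_F)
      + (if a = 0 then 0 else divpow Echeck (a - 1) * F_bracket (a - 1))"
  proof (cases a)
    case 0
    then show ?thesis by (simp add: divpow_def)
  next
    case (Suc n)
    have e: "- 2 * int (Suc n) = - 2 * int n - 2" by simp
    show ?thesis
      unfolding Suc F_divpow_Echeck e by simp
  qed
  have "divpow Echeck a * U_F * h * divpow U_F b = divpow Echeck a * h' * (U_F * divpow U_F b)"
    by (simp only: mult.assoc [of _ U_F] assms) (simp only: mult.assoc)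
  also have "\<dots> = qint (int b + 1) *\<^sub>q (divpow Echeck a * h' * divpow U_F (Suc b))"
    by (simp only: mult_divpow U_scale_simps)
  finally have F': "divpow Echeck a * U_F * h * divpow U_F b
      = qint (int b + 1) *\<^sub>q (divpow Echeck a * h' * divpow U_F (Suc b))" .
  have "U_F * (divpow Echeck a * h * divpow U_F b)
      = q powi (- 2 * int a) *\<^sub>q (divpow Echeck a * U_F * h * divpow U_F b)
        + (if a = 0 then 0 else divpow Echeck (a - 1) * (F_bracket (a - 1) * h) * divpow U_F b)"
    by (simp only: mult.assoc [symmetric] F distrib_right U_scale_mult_left) (simp add: mult.assoc)
  then show ?thesis
    unfolding F' by (simp add: tt_def distrib_right E add.assoc)
qed

text \<open>The weight of \<open>c\<close> is doubled because a factor of the braces takes the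
place of one \<open>Echeck\<close> and one \<open>F\<close>.\<close>

definition weighted :: "nat \<Rightarrow> (nat \<times> nat \<times> nat) set" where
  "weighted n = {(c, a, b). 2 * c + a + b = n}"

lemma finite_weighted [simp]: "finite (weighted n)"
  by (rule finite_subset [of _ "{..n} \<times> {..n} \<times> {..n}"]) (auto simp: weighted_def)

lemma sum_weighted:
  "(\<Sum>(c, a, b)\<in>weighted n. f c a b) = (\<Sum>c = 0..n div 2. \<Sum>a = 0..n - 2 * c. f c a (n - 2 * c - a))"
proof -
  have "(\<Sum>c = 0..n div 2. \<Sum>a = 0..n - 2 * c. f c a (n - 2 * c - a))
      = (\<Sum>(c, a)\<in>(SIGMA c:{0..n div 2}. {0..n - 2 * c}). f c a (n - 2 * c - a))"
    by (simp add: sum.Sigma)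
  also have "\<dots> = (\<Sum>(c, a, b)\<in>weighted n. f c a b)"
    by (rule sum.reindex_bij_witness
          [of _ "\<lambda>(c, a, b). (c, a)" "\<lambda>(c, a). (c, a, n - 2 * c - a)"])
       (auto simp: weighted_def)
  finally show ?thesis ..
qed

text \<open>The common shape of the two expansions: the part of the exponent of \<open>q\<close>
that depends on \<open>c\<close> is \<open>e\<close>, and \<open>H\<close> is the family of torus
elements in the middle.\<close>

definition normal_sum :: "(nat \<Rightarrow> int) \<Rightarrow> (nat \<Rightarrow> Uq) \<Rightarrow> nat \<Rightarrow> Uq" where
  "normal_sum e H n = (\<Sum>(c, a, b)\<in>weighted n.
     q powi (e c - int a * int b) *\<^sub>q (divpow Echeck a * H c * divpow U_F b))"

text \<open>What stands between \<open>divpow Echeck a\<close> and \<open>divpow U_F b\<close> in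
the component of index \<open>(c, a, b)\<close> of \<open>tt\<close> times a normal sum. The three
terms come from the indices \<open>(c, a - 1, b)\<close>, \<open>(c, a, b - 1)\<close> and
\<open>(c - 1, a + 1, b)\<close>. If \<open>a\<close> or \<open>b\<close> is zero the
corresponding index does not exist, which the factor \<open>qint 0 = 0\<close> takes into
account.\<close>

definition middle_factor :: "(nat \<Rightarrow> int) \<Rightarrow> (nat \<Rightarrow> Uq) \<Rightarrow> (nat \<Rightarrow> Uq) \<Rightarrow> nat \<Rightarrow> nat \<Rightarrow> nat \<Rightarrow> Uq" where
  "middle_factor e H H' c a b =
     (q powi (e c - int a * int b + int b) * qint (int a)) *\<^sub>q H c
   + (q powi (e c - int a * int b - int a) * qint (int b)) *\<^sub>q H' c
   + (if c = 0 then 0 else q powi (e (c - 1) - (int a + 1) * int b) *\<^sub>q (F_bracket a * H (c - 1)))"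

lemma tt_mult_normal_sum:
  assumes "\<And>c. U_F * H c = H' c * U_F"
  shows "tt * normal_sum e H n =
    (\<Sum>(c, a, b)\<in>weighted (Suc n). divpow Echeck a * middle_factor e H H' c a b * divpow U_F b)"
proof -
  define w where "w c a b = q powi (e c - int a * int b)" for c a b
  define A where "A = (\<lambda>(c, a, b). (w c a b * qint (int a + 1)) *\<^sub>q
      (divpow Echeck (Suc a) * H c * divpow U_F b))"
  define B where "B = (\<lambda>(c, a, b). (w c a b * (q powi (- 2 * int a) * qint (int b + 1))) *\<^sub>q
      (divpow Echeck a * H' c * divpow U_F (Suc b)))"
  define C where "C = (\<lambda>(c, a, b). if a = 0 then 0 else
      w c a b *\<^sub>q (divpow Echeck (a - 1) * (F_bracket (a - 1) * H c) * divpow U_F b))"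
  define A' where "A' = (\<lambda>(c, a, b). (q powi (e c - int a * int b + int b) * qint (int a)) *\<^sub>q
      (divpow Echeck a * H c * divpow U_F b))"
  define B' where "B' = (\<lambda>(c, a, b). (q powi (e c - int a * int b - int a) * qint (int b)) *\<^sub>q
      (divpow Echeck a * H' c * divpow U_F b))"
  define C' where "C' = (\<lambda>(c, a, b). if c = 0 then 0 else
      q powi (e (c - 1) - (int a + 1) * int b) *\<^sub>q
        (divpow Echeck a * (F_bracket a * H (c - 1)) * divpow U_F b))"
  have "tt * normal_sum e H n = (\<Sum>p\<in>weighted n. A p + B p + C p)"
    unfolding normal_sum_def sum_distrib_left
    by (intro sum.cong refl)
       (auto simp: tt_mult_monomial [OF assms] A_def B_def C_def w_def U_scale_simps)
  also have "\<dots> = sum A (weighted n) + sum B (weighted n) + sum C (weighted n)"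
    by (simp add: sum.distrib)
  \<comment> \<open>Each of the three sums is shifted to the indices of weight \<open>n + 1\<close>. The indices that are not
     hit are those with \<open>a = 0\<close>, \<open>b = 0\<close> and \<open>c = 0\<close>, and there the summand vanishes.\<close>
  also have "sum A (weighted n) = sum A' (weighted (Suc n))"
    by (rule sum.reindex_bij_witness_not_neutral [where S' = "{}"
          and T' = "{(c, a, b) \<in> weighted (Suc n). a = 0}"
          and i = "\<lambda>(c, a, b). (c, a - 1, b)" and j = "\<lambda>(c, a, b). (c, Suc a, b)"])
       (auto simp: weighted_def A_def A'_def w_def algebra_simps
          intro: finite_subset [OF _ finite_weighted [of "Suc n"]])
  also have "sum B (weighted n) = sum B' (weighted (Suc n))"
    by (rule sum.reindex_bij_witness_not_neutral [where S' = "{}"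
          and T' = "{(c, a, b) \<in> weighted (Suc n). b = 0}"
          and i = "\<lambda>(c, a, b). (c, a, b - 1)" and j = "\<lambda>(c, a, b). (c, a, Suc b)"])
       (auto simp: weighted_def B_def B'_def w_def algebra_simps simp flip: q_powi_add mult.assoc
          intro: finite_subset [OF _ finite_weighted [of "Suc n"]])
  \<comment> \<open>The triple \<open>(0, 0, 0)\<close> is a dummy image with \<open>C' = 0\<close> for the indices at which \<open>C\<close> vanishes.\<close>
  also have "sum C (weighted n) = sum C' (weighted (Suc n))"
    by (rule sum.reindex_bij_witness_not_neutral [where S' = "{(c, a, b) \<in> weighted n. a = 0}"
          and T' = "{(c, a, b) \<in> weighted (Suc n). c = 0}"
          and i = "\<lambda>(c, a, b). (c - 1, Suc a, b)"
          and j = "\<lambda>(c, a, b). if a = 0 then (0, 0, 0) else (Suc c, a - 1, b)"])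
       (auto simp: weighted_def C_def C'_def w_def split: if_split_asm
          intro: finite_subset [OF _ finite_weighted [of n]]
                 finite_subset [OF _ finite_weighted [of "Suc n"]])
  also have "sum A' (weighted (Suc n)) + sum B' (weighted (Suc n)) + sum C' (weighted (Suc n))
      = (\<Sum>p\<in>weighted (Suc n). A' p + B' p + C' p)"
    by (simp add: sum.distrib)
  also have "\<dots> = (\<Sum>(c, a, b)\<in>weighted (Suc n).
      divpow Echeck a * middle_factor e H H' c a b * divpow U_F b)"
    by (intro sum.cong refl)
       (auto simp: A'_def B'_def C'_def middle_factor_def U_scale_simps distrib_left distrib_right)
  finally show ?thesis .
qed


section \<open>The recursion of the divided powers of \<open>tt\<close>\<close>

lemma tt_odd_0: "tt_odd 0 = 1"
  by (simp add: tt_odd_def)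

lemma tt_mult_tt_odd_even: "tt * tt_odd (2 * m) = qint (2 * int m + 1) *\<^sub>q tt_odd (2 * m + 1)"
proof -
  have "qint (2 * int m + 1) \<noteq> 0" by (rule qint_neq_0) simp
  then show ?thesis
    unfolding tt_odd_even_index tt_odd_odd_index
    using qfact_Suc [of "2 * m"] by (simp add: U_scale_simps)
qed

text \<open>Passing from \<open>m\<close> to \<open>m + 1\<close> adds one factor at each end of
the product, namely \<open>tt + [2m + 1]\<close> and \<open>tt - [2m + 1]\<close>, so that the
product is multiplied by \<open>tt\<^sup>2 - [2m + 1]\<^sup>2\<close>.\<close>

lemma tt_mult_tt_odd_odd:
  "tt * tt_odd (2 * m + 1) = qint (2 * int m + 2) *\<^sub>q tt_odd (2 * (m + 1))
     + qint (2 * int m + 1) *\<^sub>q tt_odd (2 * m)"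
proof -
  define P where "P = (\<Prod>i\<leftarrow>[1 - int m..int m]. tt - qint (2 * i - 1) *\<^sub>q 1)"
  define d where "d = qint (2 * int m + 1)"
  have P: "tt * P = P * tt"
    unfolding P_def
    by (rule commute_prod_list) (auto simp: left_diff_distrib right_diff_distrib U_scale_simps)
  have nz: "d \<noteq> 0" "qint (2 * int m + 2) \<noteq> 0"
    unfolding d_def by (rule qint_neq_0, simp)+
  have ivl: "[1 - int (m + 1)..int (m + 1)] = [- int m] @ [1 - int m..int m] @ [int m + 1]"
  proof -
    have "[- int m..int m + 1] = - int m # [1 - int m..int m + 1]"
      by (subst upto_rec1) auto
    also have "[1 - int m..int m + 1] = [1 - int m..int m] @ [int m + 1]"
      by (subst upto_rec2) auto
    finally show ?thesis by (simp add: add.commute)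
  qed
  have "- 2 * int m - 1 = - (2 * int m + 1)" by simp
  then have d': "qint (- 2 * int m - 1) = - d"
    unfolding d_def by (simp only: qint_uminus)
  have "(\<Prod>i\<leftarrow>[1 - int (m + 1)..int (m + 1)]. tt - qint (2 * i - 1) *\<^sub>q 1)
      = (tt + d *\<^sub>q 1) * (P * (tt - d *\<^sub>q 1))"
    unfolding ivl using d' by (simp add: P_def d_def algebra_simps)
  also have "\<dots> = tt * (tt * P) - (d * d) *\<^sub>q P"
    by (simp add: algebra_simps U_scale_simps P flip: P)
  finally have prod: "(\<Prod>i\<leftarrow>[1 - int (m + 1)..int (m + 1)]. tt - qint (2 * i - 1) *\<^sub>q 1)
      = tt * (tt * P) - (d * d) *\<^sub>q P" .
  have f1: "qfact (2 * m + 1) = d * qfact (2 * m)"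
    using qfact_Suc [of "2 * m"] by (simp add: d_def)
  have f2: "qfact (2 * (m + 1)) = qint (2 * int m + 2) * (d * qfact (2 * m))"
    using qfact_Suc [of "2 * m + 1"] f1 by (simp add: add.commute)
  show ?thesis
    unfolding tt_odd_even_index tt_odd_odd_index prod f1 f2 P_def [symmetric] d_def [symmetric]
    using nz by (simp add: U_scale_simps)
qed


section \<open>Comparison of coefficients\<close>

text \<open>The coefficients of \<open>U_Kinv\<^sup>2\<close> and of \<open>1\<close> in the
comparison of the components of index \<open>(c, a, b)\<close> on the two sides of the recursion,
with \<open>x\<close>, \<open>y\<close>, \<open>z\<close> for the powers of \<open>q\<close> to
\<open>a\<close>, \<open>b\<close>, \<open>c\<close>. The first two lemmas serve the recursion
that produces the odd index, where \<open>q powi (2m + 1) = x * y * z\<^sup>2\<close>. The other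
two serve the one that produces the even index, where \<open>q powi (2m + 2) = x * y *
z\<^sup>2\<close>. Clearing denominators leaves polynomial identities modulo \<open>z ^ 4 = D +
1\<close>.\<close>

lemma odd_index_coeff_k:
  fixes q x y z :: "'a :: field"
  assumes "q \<noteq> 0" "x \<noteq> 0" "y \<noteq> 0" "z \<noteq> 0" "q\<^sup>2 \<noteq> 1" "z ^ 4 \<noteq> 1"
  defines "D \<equiv> z ^ 4 - 1" and "R \<equiv> q\<^sup>2 - 1"
  shows "y / z * (q * (x - inverse x) / R) * (q\<^sup>2 / (x\<^sup>2 * y\<^sup>2) / D)
      + 1 / (z * x) * (q * (y - inverse y) / R) * (q\<^sup>2 / (x\<^sup>2 * y\<^sup>2 * z ^ 4) / D)
      + q ^ 3 / (z ^ 5 * y) * (1 / x ^ 3 / R)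
     = 1 / z ^ 3 * (q * (x * y * z\<^sup>2 - inverse (x * y * z\<^sup>2)) / R) * (q\<^sup>2 / (x\<^sup>2 * y\<^sup>2) / D)"
proof -
  have "D \<noteq> 0" "R \<noteq> 0" using assms by auto
  have z: "z ^ 4 = D + 1" by (simp add: D_def)
  show ?thesis
    using assms(1-4) \<open>D \<noteq> 0\<close> \<open>R \<noteq> 0\<close> by (simp add: divide_simps) (use z in algebra)
qed

lemma odd_index_coeff_1:
  fixes q x y z :: "'a :: field"
  assumes "q \<noteq> 0" "x \<noteq> 0" "y \<noteq> 0" "z \<noteq> 0" "q\<^sup>2 \<noteq> 1" "z ^ 4 \<noteq> 1"
  defines "D \<equiv> z ^ 4 - 1" and "R \<equiv> q\<^sup>2 - 1"
  shows "y / z * (q * (x - inverse x) / R) * (- (q\<^sup>2) / D)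
      + 1 / (z * x) * (q * (y - inverse y) / R) * (- (q\<^sup>2) / D)
      + q ^ 3 / (z ^ 5 * y) * (- (1 / x) / R)
     = 1 / z ^ 3 * (q * (x * y * z\<^sup>2 - inverse (x * y * z\<^sup>2)) / R) * (- (q\<^sup>2) / D)"
proof -
  have "D \<noteq> 0" "R \<noteq> 0" using assms by auto
  have z: "z ^ 4 = D + 1" by (simp add: D_def)
  show ?thesis
    using assms(1-4) \<open>D \<noteq> 0\<close> \<open>R \<noteq> 0\<close> by (simp add: divide_simps) (use z in algebra)
qed

lemma even_index_coeff_k:
  fixes q x y z :: "'a :: field"
  assumes "q \<noteq> 0" "x \<noteq> 0" "y \<noteq> 0" "z \<noteq> 0" "q\<^sup>2 \<noteq> 1" "z ^ 4 \<noteq> 1"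
  defines "D \<equiv> z ^ 4 - 1" and "R \<equiv> q\<^sup>2 - 1" and "P \<equiv> q ^ 4 / (x\<^sup>2 * y\<^sup>2)"
  shows "y / z ^ 3 * (q * (x - inverse x) / R) * (P / D)
      + 1 / (z ^ 3 * x) * (q * (y - inverse y) / R) * (P / z ^ 4 / D)
      + q ^ 5 / (z ^ 7 * y) * (1 / x ^ 3 / R)
     = 1 / z * (q * (x * y * z\<^sup>2 - inverse (x * y * z\<^sup>2)) / R) * (P / z ^ 4 / D)"
proof -
  have "D \<noteq> 0" "R \<noteq> 0" using assms by auto
  have z: "z ^ 4 = D + 1" by (simp add: D_def)
  show ?thesis
    using assms(1-4) \<open>D \<noteq> 0\<close> \<open>R \<noteq> 0\<close> unfolding P_def by (simp add: divide_simps) (use z in algebra)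
qed

lemma even_index_coeff_1:
  fixes q x y z :: "'a :: field"
  assumes "q \<noteq> 0" "x \<noteq> 0" "y \<noteq> 0" "z \<noteq> 0" "q\<^sup>2 \<noteq> 1" "z ^ 4 \<noteq> 1"
  defines "D \<equiv> z ^ 4 - 1" and "R \<equiv> q\<^sup>2 - 1"
  shows "y / z ^ 3 * (q * (x - inverse x) / R) * (- (q\<^sup>2) / D)
      + 1 / (z ^ 3 * x) * (q * (y - inverse y) / R) * (- (q\<^sup>2) / D)
      + q ^ 5 / (z ^ 7 * y) * (- (1 / x) / R)
     = 1 / z * (q * (x * y * z\<^sup>2 - inverse (x * y * z\<^sup>2)) / R) * (- (q\<^sup>2) / D)
      + q ^ 3 / z ^ 5 * (q * (x * y * z\<^sup>2 / q - inverse (x * y * z\<^sup>2 / q)) / R)"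
proof -
  have "D \<noteq> 0" "R \<noteq> 0" using assms by auto
  have z: "z ^ 4 = D + 1" by (simp add: D_def)
  show ?thesis
    using assms(1-4) \<open>D \<noteq> 0\<close> \<open>R \<noteq> 0\<close> by (simp add: divide_simps) (use z in algebra)
qed

text \<open>The exponents \<open>binom2 (2c)\<close> and \<open>binom2 (2c - 1) - 1\<close> of the
two identities, in expanded form.\<close>

definition expo_even :: "nat \<Rightarrow> int" where
  "expo_even c = 2 * int c * int c - int c"

definition expo_odd :: "nat \<Rightarrow> int" where
  "expo_odd c = 2 * int c * int c - 3 * int c"

lemma middle_factor_0:
  assumes "H 0 = 1" "H' 0 = 1" "e 0 = 0"
  shows "middle_factor e H H' 0 a b = (qint (int (a + b)) * q powi (- (int a * int b))) *\<^sub>q 1"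
proof -
  have "q powi (e 0 - int a * int b + int b) * qint (int a)
      + q powi (e 0 - int a * int b - int a) * qint (int b)
      = q powi (- (int a * int b)) * (q powi int b * qint (int a) + q powi - int a * qint (int b))"
    using assms by (simp only: diff_conv_add_uminus q_powi_add add_0 distrib_left mult.assoc)
  also have "\<dots> = qint (int (a + b)) * q powi (- (int a * int b))"
    by (simp only: qint_add of_nat_add) (rule mult.commute)
  finally show ?thesis
    using assms by (simp add: middle_factor_def flip: U_vs.scale_left_distrib)
qed

text \<open>For \<open>c = 0\<close> this is \<open>qint_add\<close>. For \<open>c > 0\<close>,
after the common factor \<open>hbrace (1 - m) (c - 1)\<close> is split off, both sides are of
degree one in \<open>U_Kinv\<^sup>2\<close>, and the two coefficients agree by the rational
identities above.\<close>

lemma middle_factor_odd: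
  assumes "2 * c + a + b = 2 * m + 1"
  shows "middle_factor expo_even (hbrace (1 - int m)) (hbrace (- int m)) c a b
    = (qint (2 * int m + 1) * q powi (expo_odd c - int a * int b)) *\<^sub>q hbrace (1 - int m) c"
proof (cases c)
  case 0
  have "2 * int m + 1 = int (a + b)" using assms 0 by simp
  then show ?thesis
    by (simp add: 0 middle_factor_0 expo_even_def expo_odd_def)
next
  case (Suc d)
  define x y z W where "x = q powi int a" and "y = q powi int b" and "z = q powi int (Suc d)"
    and "W = q powi (2 * int c * int c - int a * int b)"
  have nz: "x \<noteq> 0" "y \<noteq> 0" "z \<noteq> 0" by (simp_all add: x_def y_def z_def)
  have "z ^ 4 = q powi (4 * int (Suc d))" by (simp only: z_def q_powi_numeral_mult)
  then have z4: "z ^ 4 \<noteq> 1" by (simp only: q_powi_eq_1_iff) simp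
  note pw = power_int_diff power_int_minus q_powi_add q_powi_numeral_mult q_neq_0 simp_thms
    power_int_1_right power_int_0_right power_int_of_nat
  \<comment> \<open>All exponents contain the quadratic part \<open>2c\<^sup>2 - a b\<close>. With \<open>W\<close> for its power of \<open>q\<close>, the
     other factors are monomials in \<open>q\<close>, \<open>x\<close>, \<open>y\<close>, \<open>z\<close>.\<close>
  have e1: "q powi (expo_even c - int a * int b + int b) = W * (y / z)"
  proof -
    have "expo_even c - int a * int b + int b
        = (2 * int c * int c - int a * int b) + (int b - int (Suc d))"
      by (simp add: expo_even_def expo_odd_def Suc algebra_simps)
    then show ?thesis unfolding W_def x_def y_def z_def by (simp only: pw)
  qed
  have e2: "q powi (expo_even c - int a * int b - int a) = W * (1 / (z * x))"
  proof -
    have "expo_even c - int a * int b - int a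
        = (2 * int c * int c - int a * int b) + (0 - (int (Suc d) + int a))"
      by (simp add: expo_even_def expo_odd_def Suc algebra_simps)
    then show ?thesis unfolding W_def x_def y_def z_def by (simp only: pw)
  qed
  have e3: "q powi (expo_even d - (int a + 1) * int b) = W * (q ^ 3 / (z ^ 5 * y))"
  proof -
    have "expo_even d - (int a + 1) * int b
        = (2 * int c * int c - int a * int b) + (int 3 - (5 * int (Suc d) + int b))"
      by (simp add: expo_even_def expo_odd_def Suc algebra_simps)
    then show ?thesis unfolding W_def x_def y_def z_def by (simp only: pw)
  qed
  have e4: "q powi (expo_odd c - int a * int b) = W * (1 / z ^ 3)"
  proof -
    have "expo_odd c - int a * int b
        = (2 * int c * int c - int a * int b) + (0 - 3 * int (Suc d))"
      by (simp add: expo_even_def expo_odd_def Suc algebra_simps)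
    then show ?thesis unfolding W_def x_def y_def z_def by (simp only: pw)
  qed
  have br: "F_bracket a = Kaff (1 / x ^ 3 / (q\<^sup>2 - 1)) (- (1 / x) / (q\<^sup>2 - 1))"
  proof -
    have "- 3 * int a = 0 - 3 * int a" "- int a = 0 - int a" by simp_all
    then show ?thesis unfolding F_bracket_def x_def by (simp only: pw)
  qed
  have m: "2 * int m + 1 = int a + int b + 2 * int (Suc d)"
    using assms Suc by simp
  have qm: "q powi (2 * int m + 1) = x * y * z\<^sup>2"
    unfolding m x_def y_def z_def by (simp only: pw)
  note hb = hbrace_Kaff [OF assms [unfolded Suc], folded x_def y_def z_def]
  note qints = qint_eq [of "int a", folded x_def] qint_eq [of "int b", folded y_def]
    qint_eq [of "2 * int m + 1", unfolded qm]
  \<comment> \<open>Brings the exponent \<open>2 * k\<close> of \<open>hbrace_Kaff\<close> into the form used in the coefficients.\<close>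
  have P: "2 * 1 = (2 :: nat)" by simp
  have k: "y / z * qint (int a) * (q ^ 2 / (x\<^sup>2 * y\<^sup>2) / (z ^ 4 - 1))
      + 1 / (z * x) * qint (int b) * (q ^ 2 / (x\<^sup>2 * y\<^sup>2) / z ^ 4 / (z ^ 4 - 1))
      + q ^ 3 / (z ^ 5 * y) * (1 / x ^ 3 / (q\<^sup>2 - 1))
      = 1 / z ^ 3 * qint (2 * int m + 1) * (q ^ 2 / (x\<^sup>2 * y\<^sup>2) / (z ^ 4 - 1))"
    using odd_index_coeff_k [OF q_neq_0 nz q_square_neq_1 z4] unfolding qints by simp
  have 1: "y / z * qint (int a) * (- (q\<^sup>2) / (z ^ 4 - 1))
      + 1 / (z * x) * qint (int b) * (- (q\<^sup>2) / (z ^ 4 - 1))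
      + q ^ 3 / (z ^ 5 * y) * (- (1 / x) / (q\<^sup>2 - 1))
      = 1 / z ^ 3 * qint (2 * int m + 1) * (- (q\<^sup>2) / (z ^ 4 - 1))"
    using odd_index_coeff_1 [OF q_neq_0 nz q_square_neq_1 z4] unfolding qints .
  have "middle_factor expo_even (hbrace (1 - int m)) (hbrace (- int m)) c a b
    = W *\<^sub>q ((y / z * qint (int a)) *\<^sub>q hbrace (1 - int m) c
        + (1 / (z * x) * qint (int b)) *\<^sub>q hbrace (- int m) c
        + (q ^ 3 / (z ^ 5 * y)) *\<^sub>q (F_bracket a * hbrace (1 - int m) d))"
    unfolding middle_factor_def e1 e2 by (simp add: Suc e3 U_scale_simps mult.assoc)
  also have "\<dots> = W *\<^sub>q ((1 / z ^ 3 * qint (2 * int m + 1)) *\<^sub>q hbrace (1 - int m) c)"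
    unfolding Suc hb br P Kaff_collect k 1 by (simp only: Kaff_scale flip: U_scale_mult_left)
  finally show ?thesis
    unfolding e4 by (simp add: mult_ac)
qed

text \<open>The recursion for \<open>tt * tt_odd (2m + 1)\<close> has a second term, which
involves \<open>tt_odd (2m)\<close>, and its summand of index \<open>c - 1\<close> contributes to
the component \<open>(c, a, b)\<close>. That summand contains no further factor
\<open>U_Kinv\<^sup>2\<close>, hence only the constant coefficients feel it.\<close>

lemma middle_factor_even:
  assumes "2 * c + a + b = 2 * m + 2"
  shows "middle_factor expo_odd (hbrace (1 - int m)) (hbrace (- int m)) c a b
    = (qint (2 * int m + 2) * q powi (expo_even c - int a * int b)) *\<^sub>q hbrace (- int m) c
      + (if c = 0 then 0 else
          (qint (2 * int m + 1) * q powi (expo_even (c - 1) - int a * int b)) *\<^sub>q hbrace (1 - int m) (c - 1))"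
proof (cases c)
  case 0
  have "2 * int m + 2 = int (a + b)" using assms 0 by simp
  then show ?thesis
    by (simp add: 0 middle_factor_0 expo_even_def expo_odd_def)
next
  case (Suc d)
  define x y z W where "x = q powi int a" and "y = q powi int b" and "z = q powi int (Suc d)"
    and "W = q powi (2 * int c * int c - int a * int b)"
  have nz: "x \<noteq> 0" "y \<noteq> 0" "z \<noteq> 0" by (simp_all add: x_def y_def z_def)
  have "z ^ 4 = q powi (4 * int (Suc d))" by (simp only: z_def q_powi_numeral_mult)
  then have z4: "z ^ 4 \<noteq> 1" by (simp only: q_powi_eq_1_iff) simp
  note pw = power_int_diff power_int_minus q_powi_add q_powi_numeral_mult q_neq_0 simp_thms
    power_int_1_right power_int_0_right power_int_of_nat
  \<comment> \<open>All exponents contain the quadratic part \<open>2c\<^sup>2 - a b\<close>. With \<open>W\<close> for its power of \<open>q\<close>, the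
     other factors are monomials in \<open>q\<close>, \<open>x\<close>, \<open>y\<close>, \<open>z\<close>.\<close>
  have e1: "q powi (expo_odd c - int a * int b + int b) = W * (y / z ^ 3)"
  proof -
    have "expo_odd c - int a * int b + int b
        = (2 * int c * int c - int a * int b) + (int b - 3 * int (Suc d))"
      by (simp add: expo_even_def expo_odd_def Suc algebra_simps)
    then show ?thesis unfolding W_def x_def y_def z_def by (simp only: pw)
  qed
  have e2: "q powi (expo_odd c - int a * int b - int a) = W * (1 / (z ^ 3 * x))"
  proof -
    have "expo_odd c - int a * int b - int a
        = (2 * int c * int c - int a * int b) + (0 - (3 * int (Suc d) + int a))"
      by (simp add: expo_even_def expo_odd_def Suc algebra_simps)
    then show ?thesis unfolding W_def x_def y_def z_def by (simp only: pw)
  qed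
  have e3: "q powi (expo_odd d - (int a + 1) * int b) = W * (q ^ 5 / (z ^ 7 * y))"
  proof -
    have "expo_odd d - (int a + 1) * int b
        = (2 * int c * int c - int a * int b) + (int 5 - (7 * int (Suc d) + int b))"
      by (simp add: expo_even_def expo_odd_def Suc algebra_simps)
    then show ?thesis unfolding W_def x_def y_def z_def by (simp only: pw)
  qed
  have e4: "q powi (expo_even c - int a * int b) = W * (1 / z)"
  proof -
    have "expo_even c - int a * int b
        = (2 * int c * int c - int a * int b) + (0 - int (Suc d))"
      by (simp add: expo_even_def expo_odd_def Suc algebra_simps)
    then show ?thesis unfolding W_def x_def y_def z_def by (simp only: pw)
  qed
  have e5: "q powi (expo_even d - int a * int b) = W * (q ^ 3 / z ^ 5)"
  proof -
    have "expo_even d - int a * int b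
        = (2 * int c * int c - int a * int b) + (int 3 - 5 * int (Suc d))"
      by (simp add: expo_even_def expo_odd_def Suc algebra_simps)
    then show ?thesis unfolding W_def x_def y_def z_def by (simp only: pw)
  qed
  have br: "F_bracket a = Kaff (1 / x ^ 3 / (q\<^sup>2 - 1)) (- (1 / x) / (q\<^sup>2 - 1))"
  proof -
    have "- 3 * int a = 0 - 3 * int a" "- int a = 0 - int a" by simp_all
    then show ?thesis unfolding F_bracket_def x_def by (simp only: pw)
  qed
  have m: "2 * int m + 2 = int a + int b + 2 * int (Suc d)"
    using assms Suc by simp
  have qm: "q powi (2 * int m + 2) = x * y * z\<^sup>2"
    unfolding m x_def y_def z_def by (simp only: pw)
  have "2 * int m + 1 = (2 * int m + 2) - 1"
    by simp
  then have qm': "q powi (2 * int m + 1) = x * y * z\<^sup>2 / q"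
    by (simp only: pw qm [unfolded pw])
  note hb = hbrace_Kaff [OF assms [unfolded Suc], folded x_def y_def z_def]
  note qints = qint_eq [of "int a", folded x_def] qint_eq [of "int b", folded y_def]
    qint_eq [of "2 * int m + 2", unfolded qm]
    qint_eq [of "2 * int m + 1", unfolded qm']
  \<comment> \<open>Brings the exponent \<open>2 * k\<close> of \<open>hbrace_Kaff\<close> into the form used in the coefficients.\<close>
  have P: "2 * 2 = (4 :: nat)" by simp
  have k: "y / z ^ 3 * qint (int a) * (q ^ 4 / (x\<^sup>2 * y\<^sup>2) / (z ^ 4 - 1))
      + 1 / (z ^ 3 * x) * qint (int b) * (q ^ 4 / (x\<^sup>2 * y\<^sup>2) / z ^ 4 / (z ^ 4 - 1))
      + q ^ 5 / (z ^ 7 * y) * (1 / x ^ 3 / (q\<^sup>2 - 1))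
      = 1 / z * qint (2 * int m + 2) * (q ^ 4 / (x\<^sup>2 * y\<^sup>2) / z ^ 4 / (z ^ 4 - 1))"
    using even_index_coeff_k [OF q_neq_0 nz q_square_neq_1 z4] unfolding qints by simp
  have 1: "y / z ^ 3 * qint (int a) * (- (q\<^sup>2) / (z ^ 4 - 1))
      + 1 / (z ^ 3 * x) * qint (int b) * (- (q\<^sup>2) / (z ^ 4 - 1))
      + q ^ 5 / (z ^ 7 * y) * (- (1 / x) / (q\<^sup>2 - 1))
      = 1 / z * qint (2 * int m + 2) * (- (q\<^sup>2) / (z ^ 4 - 1)) + q ^ 3 / z ^ 5 * qint (2 * int m + 1)"
    using even_index_coeff_1 [OF q_neq_0 nz q_square_neq_1 z4] unfolding qints .
  have "middle_factor expo_odd (hbrace (1 - int m)) (hbrace (- int m)) c a b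
    = W *\<^sub>q ((y / z ^ 3 * qint (int a)) *\<^sub>q hbrace (1 - int m) c
        + (1 / (z ^ 3 * x) * qint (int b)) *\<^sub>q hbrace (- int m) c
        + (q ^ 5 / (z ^ 7 * y)) *\<^sub>q (F_bracket a * hbrace (1 - int m) d))"
    unfolding middle_factor_def e1 e2 by (simp add: Suc e3 U_scale_simps mult.assoc)
  also have "\<dots> = W *\<^sub>q ((1 / z * qint (2 * int m + 2)) *\<^sub>q hbrace (- int m) c
      + (q ^ 3 / z ^ 5 * qint (2 * int m + 1)) *\<^sub>q hbrace (1 - int m) d)"
  proof -
    have "Kaff s (t + r) * h = Kaff s t * h + r *\<^sub>q h" for s t r h
      by (simp add: Kaff_def U_scale_simps U_vs.scale_left_distrib distrib_right)
    then show ?thesis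
      unfolding Suc hb br P Kaff_collect k 1 by (simp only: Kaff_scale flip: U_scale_mult_left)
  qed
  finally show ?thesis
    unfolding e4 by (simp add: Suc e5 U_scale_simps mult_ac)
qed


section \<open>The expansion\<close>

lemma normal_sum_odd_step:
  "tt * normal_sum expo_even (hbrace (1 - int m)) (2 * m)
     = qint (2 * int m + 1) *\<^sub>q normal_sum expo_odd (hbrace (1 - int m)) (2 * m + 1)"
  unfolding tt_mult_normal_sum [OF F_hbrace_shift]
  unfolding normal_sum_def U_vs.scale_sum_right
  by (intro sum.cong) (auto simp: weighted_def middle_factor_odd U_scale_simps)

lemma normal_sum_even_step:
  "tt * normal_sum expo_odd (hbrace (1 - int m)) (2 * m + 1)
     = qint (2 * int m + 2) *\<^sub>q normal_sum expo_even (hbrace (- int m)) (2 * m + 2)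
       + qint (2 * int m + 1) *\<^sub>q normal_sum expo_even (hbrace (1 - int m)) (2 * m)"
proof -
  define A where "A = (\<lambda>(c, a, b). qint (2 * int m + 2) *\<^sub>q q powi (expo_even c - int a * int b) *\<^sub>q
    (divpow Echeck a * hbrace (- int m) c * divpow U_F b))"
  define B where "B = (\<lambda>(c, a, b). qint (2 * int m + 1) *\<^sub>q q powi (expo_even c - int a * int b) *\<^sub>q
    (divpow Echeck a * hbrace (1 - int m) c * divpow U_F b))"
  define B' where "B' = (\<lambda>(c, a, b). if c = 0 then 0 else B (c - 1, a, b))"
  \<comment> \<open>The index \<open>c\<close> of the sum of weight \<open>2m\<close> is raised by one to reach weight \<open>2m + 2\<close>.\<close>
  have shift: "sum B (weighted (2 * m)) = sum B' (weighted (2 * m + 2))"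
    by (rule sum.reindex_bij_witness_not_neutral [where S' = "{}"
          and T' = "{(c, a, b) \<in> weighted (2 * m + 2). c = 0}"
          and i = "\<lambda>(c, a, b). (c - 1, a, b)" and j = "\<lambda>(c, a, b). (Suc c, a, b)"])
       (auto simp: weighted_def B'_def intro: finite_subset [OF _ finite_weighted [of "2 * m + 2"]])
  have "tt * normal_sum expo_odd (hbrace (1 - int m)) (2 * m + 1)
      = (\<Sum>p\<in>weighted (2 * m + 2). A p + B' p)"
    unfolding tt_mult_normal_sum [OF F_hbrace_shift]
    by (intro sum.cong)
       (auto simp: weighted_def middle_factor_even A_def B_def B'_def U_scale_simps distrib_left distrib_right)
  also have "\<dots> = sum A (weighted (2 * m + 2)) + sum B' (weighted (2 * m + 2))"
    by (rule sum.distrib)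
  finally show ?thesis
    unfolding shift [symmetric]
    by (simp add: normal_sum_def U_vs.scale_sum_right A_def B_def case_prod_unfold)
qed

lemma tt_odd_normal_sum_odd:
  assumes "tt_odd (2 * m) = normal_sum expo_even (hbrace (1 - int m)) (2 * m)"
  shows "tt_odd (2 * m + 1) = normal_sum expo_odd (hbrace (1 - int m)) (2 * m + 1)"
proof -
  have "qint (2 * int m + 1) \<noteq> 0" by (rule qint_neq_0) simp
  moreover have "qint (2 * int m + 1) *\<^sub>q tt_odd (2 * m + 1)
      = qint (2 * int m + 1) *\<^sub>q normal_sum expo_odd (hbrace (1 - int m)) (2 * m + 1)"
    by (simp only: assms normal_sum_odd_step flip: tt_mult_tt_odd_even)
  ultimately show ?thesis by (rule U_vs.scale_left_imp_eq)
qed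

lemma tt_odd_normal_sum_even: "tt_odd (2 * m) = normal_sum expo_even (hbrace (1 - int m)) (2 * m)"
proof (induction m)
  case 0
  have "weighted 0 = {(0, 0, 0)}" by (auto simp: weighted_def)
  then show ?case by (simp add: normal_sum_def tt_odd_0 expo_even_def divpow_def)
next
  case (Suc m)
  have "qint (2 * int m + 2) \<noteq> 0" by (rule qint_neq_0) simp
  moreover have "qint (2 * int m + 2) *\<^sub>q tt_odd (2 * (m + 1))
      = qint (2 * int m + 2) *\<^sub>q normal_sum expo_even (hbrace (- int m)) (2 * m + 2)"
    using tt_mult_tt_odd_odd [of m]
    unfolding tt_odd_normal_sum_odd [OF Suc] normal_sum_even_step Suc by (metis add_right_cancel)
  ultimately have "tt_odd (2 * (m + 1)) = normal_sum expo_even (hbrace (- int m)) (2 * m + 2)"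
    by (rule U_vs.scale_left_imp_eq)
  then show ?case by simp
qed

lemma binom2_eq: "2 * k = x * (x - 1) \<Longrightarrow> binom2 x = k"
  unfolding binom2_def by (metis nonzero_mult_div_cancel_left zero_neq_numeral)

theorem theorem3p1:
  fixes m :: nat
  shows "tt_odd (2 * m) =
      (\<Sum>c = 0..m. \<Sum>a = 0..2 * m - 2 * c.
         q powi (binom2 (2 * int c) - int a * (2 * int m - 2 * int c - int a)) *\<^sub>q
           (divpow Echeck a * hbrace (1 - int m) c * divpow U_F (2 * m - 2 * c - a)))
    \<and> tt_odd (2 * m + 1) =
      (\<Sum>c = 0..m. \<Sum>a = 0..2 * m + 1 - 2 * c.
         q powi (binom2 (2 * int c - 1) - 1 - int a * (2 * int m + 1 - 2 * int c - int a)) *\<^sub>q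
           (divpow Echeck a * hbrace (1 - int m) c * divpow U_F (2 * m + 1 - 2 * c - a)))"
proof
  have e: "binom2 (2 * int c) = expo_even c" for c
    by (rule binom2_eq) (simp add: expo_even_def algebra_simps)
  have "binom2 (2 * int c - 1) = expo_odd c + 1" for c
    by (rule binom2_eq) (simp add: expo_odd_def algebra_simps)
  then have o: "binom2 (2 * int c - 1) - 1 = expo_odd c" for c
    by simp
  show "tt_odd (2 * m) =
      (\<Sum>c = 0..m. \<Sum>a = 0..2 * m - 2 * c.
         q powi (binom2 (2 * int c) - int a * (2 * int m - 2 * int c - int a)) *\<^sub>q
           (divpow Echeck a * hbrace (1 - int m) c * divpow U_F (2 * m - 2 * c - a)))"
    unfolding tt_odd_normal_sum_even normal_sum_def sum_weighted e
    by (intro sum.cong) (auto simp: of_nat_diff diff_diff_eq)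
  show "tt_odd (2 * m + 1) =
      (\<Sum>c = 0..m. \<Sum>a = 0..2 * m + 1 - 2 * c.
         q powi (binom2 (2 * int c - 1) - 1 - int a * (2 * int m + 1 - 2 * int c - int a)) *\<^sub>q
           (divpow Echeck a * hbrace (1 - int m) c * divpow U_F (2 * m + 1 - 2 * c - a)))"
    unfolding tt_odd_normal_sum_odd [OF tt_odd_normal_sum_even] normal_sum_def sum_weighted o
    by (intro sum.cong) (auto simp: of_nat_diff diff_diff_eq add.commute)
qed

end
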